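(* Let $G=(V(G),E(G))$ and $H=(V(H),E(H))$ be finite simple graphs such that $V(H)=V(G)\cup\{w\}$ with $w\notin V(G)$, and $E(H)=E(G)\cup\{\{v,w\}\}$ for some vertex $v\in V(G)$. Let $J(G)$ and $J(H)$ be the cover ideals of $G$ and $H$, respectively. If $J(G)$ is normal, then $J(H)$ is normal.
   Context: Let $K$ be a field. For a finite simple graph $G$ (undirected, no loops, no multiple edges), a vertex cover of $G$ is a subset $W\subseteq V(G)$ that intersects every edge of $G$; it is minimal if no proper subset of it is a vertex cover. If $W_1,\ldots,W_r$ are the minimal vertex covers of $G$, the cover ideal of $G$ is the ideal $J(G)=(X_{W_1},\ldots,X_{W_r})$ of the polynomial ring $K[x_u : u\in V(G)]$, where $X_{W_j}=\prod_{u\in W_j}x_u$. Each cover ideal is considered in the polynomial ring over $K$ in the variables indexed by the vertices of the graph. For an ideal $I$ of a commutative ring $R$, an element $f\in R$ is integral over $I$ if there is an equation $f^k+c_1f^{k-1}+\cdots+c_{k-1}f+c_k=0$ with $c_i\in I^i$. The set $\overline{I}$ of elements integral over $I$ is the integral closure of $I$; $I$ is integrally closed if $I=\overline{I}$, and $I$ is normal if all powers $I^t$, $t\ge 1$, are integrally closed. *)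

theory Defs
  imports "HOL-Algebra.Ideal_Product" "HOL-Library.Poly_Mapping"
begin

section \<open>Integral closure of ideals\<close>

text \<open>In the library's structure \<^term>\<open>ideals_set R\<close> multiplication is the product of ideals and the
  unit is the carrier of \<open>R\<close>, so its power operation is the power \<open>I\<^sup>n\<close> of ideals.\<close>

abbreviation ideal_power :: "('a, 'b) ring_scheme \<Rightarrow> 'a set \<Rightarrow> nat \<Rightarrow> 'a set" where
  "ideal_power R I n \<equiv> I [^]\<^bsub>ideals_set R\<^esub> n"

definition integral_over :: "('a, 'b) ring_scheme \<Rightarrow> 'a set \<Rightarrow> 'a \<Rightarrow> bool" where
  "integral_over R I f \<longleftrightarrow>
     (\<exists>(k::nat) c. k \<ge> 1 \<and> (\<forall>i\<in>{1..k}. c i \<in> ideal_power R I i) \<and>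
        f [^]\<^bsub>R\<^esub> k \<oplus>\<^bsub>R\<^esub> (\<Oplus>\<^bsub>R\<^esub>i\<in>{1..k}. c i \<otimes>\<^bsub>R\<^esub> f [^]\<^bsub>R\<^esub> (k - i)) = \<zero>\<^bsub>R\<^esub>)"

definition integral_closure :: "('a, 'b) ring_scheme \<Rightarrow> 'a set \<Rightarrow> 'a set" where
  "integral_closure R I = {f \<in> carrier R. integral_over R I f}"

definition integrally_closed :: "('a, 'b) ring_scheme \<Rightarrow> 'a set \<Rightarrow> bool" where
  "integrally_closed R I \<longleftrightarrow> I = integral_closure R I"

definition normal_ideal :: "('a, 'b) ring_scheme \<Rightarrow> 'a set \<Rightarrow> bool" where
  "normal_ideal R I \<longleftrightarrow> (\<forall>t::nat. t \<ge> 1 \<longrightarrow> integrally_closed R (ideal_power R I t))"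

section \<open>Polynomial rings in a set of variables\<close>

text \<open>Exponent vectors are finitely supported functions \<open>'v \<Rightarrow>\<^sub>0 nat\<close>, and polynomials are finitely
  supported families of coefficients indexed by them. The type contains a variable for every
  element of \<open>'v\<close>; \<open>poly_ring V\<close> is the subring \<open>K[x\<^sub>u : u \<in> V]\<close>.\<close>

type_synonym ('v, 'k) mpoly = "('v \<Rightarrow>\<^sub>0 nat) \<Rightarrow>\<^sub>0 'k"

definition poly_ring :: "'v set \<Rightarrow> ('v, 'k::field) mpoly ring" where
  "poly_ring V = \<lparr>carrier = {p. \<forall>m\<in>Poly_Mapping.keys p. Poly_Mapping.keys m \<subseteq> V},
                  mult = (*), one = 1, zero = 0, add = (+)\<rparr>"

definition var :: "'v \<Rightarrow> ('v, 'k::field) mpoly" where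
  "var u = Poly_Mapping.single (Poly_Mapping.single u 1) 1"

lemma cring_poly_ring: "cring (poly_ring V :: ('v, 'k::field) mpoly ring)"
proof -
  let ?R = "poly_ring V :: ('v, 'k) mpoly ring"
  have mult: "p * q \<in> carrier ?R" if "p \<in> carrier ?R" "q \<in> carrier ?R" for p q
    
  proof -
    have "Poly_Mapping.keys m \<subseteq> V" if m: "m \<in> Poly_Mapping.keys (p * q)" for m
    proof -
      obtain a b where "m = a + b" "a \<in> Poly_Mapping.keys p" "b \<in> Poly_Mapping.keys q"
        using m keys_mult[of p q] by blast
      then show ?thesis
        using that keys_add[of a b] \<open>p \<in> _\<close> \<open>q \<in> _\<close> by (auto simp: poly_ring_def)
    qed
    then show ?thesis by (simp add: poly_ring_def)
  qed
  have add: "p + q \<in> carrier ?R" if "p \<in> carrier ?R" "q \<in> carrier ?R" for p q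
    using that keys_add[of p q] by (auto simp: poly_ring_def)
  have uminus: "- p \<in> carrier ?R" if "p \<in> carrier ?R" for p
    using that by (simp add: poly_ring_def)
  have zero: "0 \<in> carrier ?R" and one: "1 \<in> carrier ?R"
    by (simp_all add: poly_ring_def)
  have ops: "p \<otimes>\<^bsub>?R\<^esub> q = p * q" "p \<oplus>\<^bsub>?R\<^esub> q = p + q" "\<one>\<^bsub>?R\<^esub> = 1" "\<zero>\<^bsub>?R\<^esub> = 0" for p q
    by (simp_all add: poly_ring_def)
  have "abelian_group ?R"
    by (rule abelian_groupI; unfold ops)
      (auto intro: add zero uminus simp: add.assoc add.commute intro!: bexI[of _ "- _"])
  moreover have "comm_monoid ?R"
    by (rule comm_monoidI; unfold ops) (auto intro: mult one simp: mult.assoc mult.commute)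
  ultimately show ?thesis
    by (rule cringI) (simp add: ops distrib_right)
qed

lemma var_in_carrier: "u \<in> V \<Longrightarrow> var u \<in> carrier (poly_ring V)"
  by (simp add: var_def poly_ring_def)

section \<open>Graphs and cover ideals\<close>

definition simple_graph :: "'v set \<Rightarrow> 'v set set \<Rightarrow> bool" where
  "simple_graph V E \<longleftrightarrow> finite V \<and> (\<forall>e\<in>E. e \<subseteq> V \<and> card e = 2)"

definition vertex_cover :: "'v set \<Rightarrow> 'v set set \<Rightarrow> 'v set \<Rightarrow> bool" where
  "vertex_cover V E W \<longleftrightarrow> W \<subseteq> V \<and> (\<forall>e\<in>E. W \<inter> e \<noteq> {})"

definition minimal_vertex_cover :: "'v set \<Rightarrow> 'v set set \<Rightarrow> 'v set \<Rightarrow> bool" where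
  "minimal_vertex_cover V E W \<longleftrightarrow> vertex_cover V E W \<and> (\<forall>W'. W' \<subset> W \<longrightarrow> \<not> vertex_cover V E W')"

definition cover_ideal :: "'v set \<Rightarrow> 'v set set \<Rightarrow> ('v, 'k::field) mpoly set" where
  "cover_ideal V E = Idl\<^bsub>poly_ring V\<^esub> {(\<Prod>u\<in>W. var u) |W. minimal_vertex_cover V E W}"

end

theory Submission
  imports Defs
begin

text \<open>The integral closure of a monomial ideal consists of the polynomials all of whose exponents \<open>m\<close>
  have a multiple \<open>n m\<close> that is the exponent of a monomial in the \<open>n\<close>-th power. Hence
  normality of a cover ideal is a statement about exponents: \<open>x\<^sup>m \<in> J\<^sup>t\<close> whenever
  \<open>x\<^sup>n\<^sup>m \<in> J\<^sup>t\<^sup>n\<close> for some \<open>n \<ge> 1\<close>. Attaching a leaf \<open>w\<close> at \<open>v\<close> adds to the condition for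
  \<open>x\<^sup>m \<in> J(G)\<^sup>t\<close> only the inequality \<open>m\<^sub>v + m\<^sub>w \<ge> t\<close>, that is,
  \<open>J(H)\<^sup>t = J(G)\<^sup>t \<inter> (x\<^sub>v, x\<^sub>w)\<^sup>t\<close>; and this inequality may be divided by \<open>n\<close>.\<close>

section \<open>Multiples of exponent vectors\<close>

abbreviation keys where "keys \<equiv> Poly_Mapping.keys"
abbreviation lookup where "lookup \<equiv> Poly_Mapping.lookup"

definition nmul :: "nat \<Rightarrow> ('v \<Rightarrow>\<^sub>0 nat) \<Rightarrow> ('v \<Rightarrow>\<^sub>0 nat)" where
  "nmul n m = Poly_Mapping.map ((*) n) m"

lemma lookup_nmul [simp]: "lookup (nmul n m) u = n * lookup m u"
  unfolding nmul_def by transfer (simp add: when_def)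

lemma nmul_add: "nmul n (a + b) = nmul n a + nmul n b"
  by (rule poly_mapping_eqI) (simp add: lookup_add algebra_simps)

lemma add_nmul: "nmul (i + j) a = nmul i a + nmul j a"
  by (rule poly_mapping_eqI) (simp add: lookup_add algebra_simps)

lemma nmul_nmul: "nmul i (nmul j a) = nmul (i * j) a"
  by (rule poly_mapping_eqI) simp

lemma nmul_0 [simp]: "nmul 0 a = 0"
  by (rule poly_mapping_eqI) simp

lemma nmul_Suc: "nmul (Suc n) a = a + nmul n a"
  by (rule poly_mapping_eqI) (simp add: lookup_add)

lemma keys_add_nat: "keys (a + b :: 'v \<Rightarrow>\<^sub>0 nat) = keys a \<union> keys b"
  by (auto simp: in_keys_iff lookup_add)

lemma single_power: "Poly_Mapping.single m (1::'k::field) ^ n = Poly_Mapping.single (nmul n m) 1"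
  by (induction n) (simp_all add: mult_single nmul_Suc)

lemma sum_single_lookup:
  fixes p :: "'a \<Rightarrow>\<^sub>0 'b::comm_monoid_add"
  shows "(\<Sum>m\<in>keys p. Poly_Mapping.single m (lookup p m)) = p"
  by (rule poly_mapping_eqI) (auto simp: lookup_sum lookup_single when_def in_keys_iff)

section \<open>Integral dependence over a filtration of exponents\<close>

text \<open>\<open>F i\<close> stands for the exponents of the \<open>i\<close>-th power of a
  monomial ideal. Since \<open>F 0\<close> is \<open>UNIV\<close>, \<open>F_add\<close> with
  \<open>j = 0\<close> makes every \<open>F i\<close> closed upward.\<close>

locale exponent_filtration =
  fixes F :: "nat \<Rightarrow> ('v \<Rightarrow>\<^sub>0 nat) set"
  assumes F_0: "F 0 = UNIV"
    and F_add: "a \<in> F i \<Longrightarrow> b \<in> F j \<Longrightarrow> a + b \<in> F (i + j)"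
begin

text \<open>The smallest additive filtration that contains \<open>F\<close> and has the elements of
  \<open>T\<close> in degree one; it is the exponent side of enlarging a Rees algebra.\<close>

inductive gen :: "('v \<Rightarrow>\<^sub>0 nat) set \<Rightarrow> nat \<Rightarrow> ('v \<Rightarrow>\<^sub>0 nat) \<Rightarrow> bool" for T where
  base: "a \<in> F i \<Longrightarrow> gen T i a"
| step: "gen T n x \<Longrightarrow> s \<in> T \<Longrightarrow> gen T (Suc n) (s + x)"

text \<open>Geometrically, \<open>m\<close> lies in the convex hull of \<open>T\<close> and the Newton polyhedron of \<open>F\<close>,
  enlarged by the positive orthant (which comes from \<open>F 0\<close>).\<close>

definition hull :: "('v \<Rightarrow>\<^sub>0 nat) set \<Rightarrow> ('v \<Rightarrow>\<^sub>0 nat) \<Rightarrow> bool" where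
  "hull T m \<longleftrightarrow> (\<exists>k\<ge>1. gen T k (nmul k m))"

lemma gen_empty: "gen {} n x \<longleftrightarrow> x \<in> F n"
  by (auto elim: gen.cases intro: gen.base)

lemma gen_mono: "gen T n x \<Longrightarrow> T \<subseteq> T' \<Longrightarrow> gen T' n x"
  by (induction rule: gen.induct) (auto intro: gen.intros)

lemma hull_mono: "hull T m \<Longrightarrow> T \<subseteq> T' \<Longrightarrow> hull T' m"
  unfolding hull_def using gen_mono by blast

lemma gen_add: "gen T i x \<Longrightarrow> gen T j y \<Longrightarrow> gen T (i + j) (x + y)"
proof (induction rule: gen.induct)
  case (base a i)
  from base(2,1) show ?case
  proof (induction rule: gen.induct)
    case (base b j)
    then show ?case by (auto intro: gen.base F_add)
  next
    case (step n x s)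
    then have "gen T (Suc (i + n)) (s + (a + x))" by (auto intro: gen.step)
    then show ?case by (simp add: ac_simps)
  qed
next
  case (step n x s)
  then have "gen T (Suc (n + j)) (s + (x + y))" by (auto intro: gen.step)
  then show ?case by (simp add: ac_simps)
qed

lemma gen_nmul: "gen T i x \<Longrightarrow> gen T (n * i) (nmul n x)"
proof (induction n)
  case 0
  then show ?case by (simp add: gen.base F_0)
next
  case (Suc n)
  then show ?case using gen_add[of T i x "n * i" "nmul n x"] by (simp add: nmul_Suc)
qed

text \<open>Collecting all copies of \<open>s\<close> gives a linear relation with a known
  multiplicity \<open>j\<close>, from which a point can be eliminated.\<close>

lemma gen_insertE:
  assumes "gen (insert s T) n x"
  obtains j y where "j \<le> n" "x = y + nmul j s" "gen T (n - j) y"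
proof -
  have "\<exists>j y. j \<le> n \<and> x = y + nmul j s \<and> gen T (n - j) y"
    using assms
  proof (induction rule: gen.induct)
    case (base a i)
    then show ?case by (intro exI[of _ 0] exI[of _ a]) (auto intro: gen.base)
  next
    case (step n x r)
    then obtain j y where jy: "j \<le> n" "x = y + nmul j s" "gen T (n - j) y" by blast
    show ?case
    proof (cases "r = s")
      case True
      with jy show ?thesis
        by (intro exI[of _ "Suc j"] exI[of _ y]) (auto simp: nmul_Suc ac_simps)
    next
      case False
      with step have "r \<in> T" by simp
      with jy have "gen T (Suc (n - j)) (r + y)" by (auto intro: gen.step)
      with jy show ?thesis
        by (intro exI[of _ j] exI[of _ "r + y"]) (auto simp: Suc_diff_le ac_simps)
    qed
  qed
  with that show thesis by blast
qed

text \<open>Scaling a representation of \<open>k m\<close> by \<open>l\<close> makes the copies of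
  \<open>s\<close> come in \<open>j\<close> blocks \<open>l s\<close>, and each block is replaced by
  its representation over \<open>T\<close>.\<close>

lemma hull_insert_eliminate:
  assumes "hull (insert s T) m" "hull T s"
  shows "hull T m"
proof -
  obtain k where k: "k \<ge> 1" "gen (insert s T) k (nmul k m)" using assms by (auto simp: hull_def)
  obtain l where l: "l \<ge> 1" "gen T l (nmul l s)" using assms by (auto simp: hull_def)
  obtain j y where jy: "j \<le> k" "nmul k m = y + nmul j s" "gen T (k - j) y"
    using k gen_insertE by metis
  have "nmul (l * k) m = nmul l y + nmul j (nmul l s)"
    using jy(2) by (simp flip: nmul_nmul) (simp add: nmul_add nmul_nmul mult.commute)
  moreover have "gen T (l * (k - j) + j * l) (nmul l y + nmul j (nmul l s))"
    by (intro gen_add gen_nmul jy l)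
  moreover have "l * (k - j) + j * l = l * k"
    using jy(1) by (metis add_mult_distrib2 le_add_diff_inverse2 mult.commute)
  ultimately show ?thesis
    unfolding hull_def using k l by (intro exI[of _ "l * k"]) auto
qed

text \<open>From \<open>k r = y + j s\<close> and \<open>l s = z + p r\<close>, eliminating
  \<open>s\<close> gives \<open>(l k - j p) r = l y + j z\<close>. The degree of the right-hand side
  is \<open>l (k - j) + j (l - p)\<close>, the same number, so only its positivity has to be
  shown.\<close>

lemma hull_exchange:
  assumes "hull (insert r T) s" "hull (insert s T) r" "r \<noteq> s"
  shows "hull T r"
proof -
  obtain k where k: "k \<ge> 1" "gen (insert s T) k (nmul k r)" using assms by (auto simp: hull_def)
  obtain l where l: "l \<ge> 1" "gen (insert r T) l (nmul l s)" using assms by (auto simp: hull_def)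
  obtain j y where j: "j \<le> k" "nmul k r = y + nmul j s" "gen T (k - j) y"
    using k gen_insertE by metis
  obtain p z where p: "p \<le> l" "nmul l s = z + nmul p r" "gen T (l - p) z"
    using l gen_insertE by metis
  have lin_j: "k * lookup r u = lookup y u + j * lookup s u" for u
    using arg_cong[OF j(2), of "\<lambda>x. lookup x u"] by (simp add: lookup_add)
  have lin_p: "l * lookup s u = lookup z u + p * lookup r u" for u
    using arg_cong[OF p(2), of "\<lambda>x. lookup x u"] by (simp add: lookup_add)
  \<comment> \<open>Equality would force \<open>j = k\<close> and \<open>p = l\<close>; as
    \<open>y\<close> and \<open>z\<close> have no negative entries, \<open>r\<close> and
    \<open>s\<close> would then dominate each other coordinatewise and coincide.\<close>
  have jp: "j * p < l * k"
  proof (rule ccontr)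
    assume "\<not> j * p < l * k"
    moreover have "j * p \<le> k * l" using j p by (simp add: mult_le_mono)
    ultimately have eq: "j * p = k * l" by (simp add: mult.commute)
    have "j = k"
    proof (rule ccontr)
      assume "j \<noteq> k"
      then have "j < k" using j by simp
      then have "j * l < k * l" using l by simp
      moreover have "j * p \<le> j * l" using p by simp
      ultimately show False using eq by simp
    qed
    moreover from this have "p = l" using eq k by simp
    ultimately have "k * lookup s u \<le> k * lookup r u" "l * lookup r u \<le> l * lookup s u" for u
      using lin_j[of u] lin_p[of u] by auto
    then have "lookup s u = lookup r u" for u
      using k l by (simp add: le_antisym)
    then show False using \<open>r \<noteq> s\<close> by (metis poly_mapping_eqI)
  qed
  have "nmul (l * k - j * p) r = nmul l y + nmul j z"
  proof (rule poly_mapping_eqI)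
    fix u
    have "(l * k) * lookup r u = l * lookup y u + j * lookup z u + (j * p) * lookup r u"
      using arg_cong[OF lin_j[of u], of "\<lambda>x. l * x"] arg_cong[OF lin_p[of u], of "\<lambda>x. j * x"]
      by (simp add: algebra_simps)
    then show "lookup (nmul (l * k - j * p) r) u = lookup (nmul l y + nmul j z) u"
      by (simp add: lookup_add diff_mult_distrib)
  qed
  moreover have "gen T (l * (k - j) + j * (l - p)) (nmul l y + nmul j z)"
    by (intro gen_add gen_nmul j p)
  moreover have "l * (k - j) + j * (l - p) = l * k - j * p"
    using j(1) p(1) by (auto simp: diff_mult_distrib2 mult.commute)
  ultimately show ?thesis
    unfolding hull_def using jp by (intro exI[of _ "l * k - j * p"]) auto
qed

text \<open>If no point of \<open>S\<close> is a vertex outside the Newton polyhedron, then all of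
  \<open>S\<close> lies in it. The induction drops one point \<open>s\<close>: by exchange, the
  other points do not need \<open>s\<close>, so the induction hypothesis applies to them.\<close>

lemma hull_empty_if_hull_others:
  assumes "finite S" "\<forall>s\<in>S. hull (S - {s}) s"
  shows "\<forall>s\<in>S. hull {} s"
  using assms
proof (induction S rule: finite_induct)
  case (insert s S)
  have s: "hull S s" using insert.prems insert.hyps by auto
  have "hull (S - {r}) r" if "r \<in> S" for r
  proof (rule hull_exchange)
    show "hull (insert r (S - {r})) s" using s that by (simp add: insert_absorb)
    show "r \<noteq> s" using that insert.hyps by auto
    moreover have "hull (insert s S - {r}) r" using insert.prems that by simp
    ultimately show "hull (insert s (S - {r})) r" by (simp add: insert_Diff_if)
  qed
  then have IH: "\<forall>r\<in>S. hull {} r" using insert.IH by blast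
  \<comment> \<open>The points on which \<open>s\<close> depends are already in
    \<open>hull {}\<close>, so they can be eliminated one at a time.\<close>
  have "hull {} s" if "finite T" "T \<subseteq> S" "hull T s" for T
    using that
  proof (induction T rule: finite_induct)
    case (insert r T)
    then have "hull T r" using IH hull_mono[of "{}" r T] by auto
    with insert show ?case using hull_insert_eliminate[of r T s] by auto
  qed
  with s insert.hyps IH show ?case by blast
qed simp

section \<open>Coefficients of powers of a polynomial at a vertex\<close>

lemma keys_power_gen:
  fixes f :: "('v, 'k::field) mpoly"
  shows "x \<in> keys (f ^ n) \<Longrightarrow> gen (keys f) n x"
proof (induction n arbitrary: x)
  case 0
  then show ?case by (simp add: gen.base F_0)
next
  case (Suc n)
  then obtain a b where "x = a + b" "a \<in> keys f" "b \<in> keys (f ^ n)"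
    using keys_mult[of f "f ^ n"] by auto
  with Suc.IH show ?case by (auto intro: gen.step)
qed

text \<open>Cancelling \<open>j m\<close> leaves \<open>(n - j) m\<close> in degree
  \<open>n - j\<close>, and \<open>j < n\<close> keeps this multiple positive.\<close>

lemma hull_if_gen_nmul:
  assumes "gen T (n - j) y" "nmul n m = y + nmul j m" "j < n"
  shows "hull T m"
proof -
  have "nmul n m = nmul (n - j) m + nmul j m"
    using assms(3) by (simp flip: add_nmul)
  then have "y = nmul (n - j) m" using assms(2) by simp
  with assms show ?thesis unfolding hull_def by (intro exI[of _ "n - j"]) auto
qed

text \<open>At a vertex \<open>m\<close>, the exponent \<open>n m\<close> arises in
  \<open>f ^ n\<close> only by choosing the term of exponent \<open>m\<close> in every factor, so
  nothing can cancel it.\<close>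

lemma lookup_power_extremal:
  fixes f :: "('v, 'k::field) mpoly"
  assumes "\<not> hull (keys f - {m}) m" "m \<in> keys f"
  shows "lookup (f ^ n) (nmul n m) = lookup f m ^ n"
proof (induction n)
  case (Suc n)
  define c where "c = lookup f m"
  define g where "g = f - Poly_Mapping.single m c"
  have keys_g: "keys g \<subseteq> keys f - {m}"
    by (auto simp: g_def c_def in_keys_iff lookup_minus lookup_single when_def split: if_splits)
  \<comment> \<open>The factor \<open>g\<close> contributes an exponent other than \<open>m\<close>,
    so at most \<open>n\<close> of the \<open>Suc n\<close> summands equal \<open>m\<close>, and
    cancelling them would put \<open>m\<close> into the forbidden hull.\<close>
  have "nmul (Suc n) m \<notin> keys (g * f ^ n)"
  proof
    assume "nmul (Suc n) m \<in> keys (g * f ^ n)"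
    then obtain a b where ab: "nmul (Suc n) m = a + b" "a \<in> keys g" "b \<in> keys (f ^ n)"
      using keys_mult[of g "f ^ n"] by auto
    then have "gen (insert m (keys f - {m})) n b"
      using keys_power_gen[of b f n] assms(2) by (simp add: insert_absorb)
    then obtain j y where jy: "j \<le> n" "b = y + nmul j m" "gen (keys f - {m}) (n - j) y"
      by (rule gen_insertE)
    then have "gen (keys f - {m}) (Suc n - j) (a + y)"
      using ab keys_g gen.step[of "keys f - {m}" "n - j" y a] by (auto simp: Suc_diff_le)
    then have "hull (keys f - {m}) m"
      using jy ab by (intro hull_if_gen_nmul[of _ "Suc n" j "a + y"]) (auto simp: ac_simps)
    with assms show False by simp
  qed
  then have "lookup (g * f ^ n) (nmul (Suc n) m) = 0" by (simp add: in_keys_iff)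
  moreover have "lookup (Poly_Mapping.single m c * f ^ n) (nmul (Suc n) m) = c * lookup (f ^ n) (nmul n m)"
    by (simp add: lookup_mult nmul_Suc lookup_single when_mult mult_when)
  moreover have "f ^ Suc n = Poly_Mapping.single m c * f ^ n + g * f ^ n"
    by (simp add: g_def algebra_simps)
  ultimately show ?case using Suc by (simp add: lookup_add c_def)
qed simp

text \<open>If the conclusion fails, some exponent \<open>m\<close> of \<open>f\<close> is a vertex of the convex hull of the exponents and the
  Newton polyhedron, and lies outside the latter. Then \<open>k m\<close> occurs in \<open>f\<^sup>k\<close> but in no other
  term of the integral equation.\<close>

lemma integral_imp_multiple_mem:
  fixes f :: "('v, 'k::field) mpoly"
  assumes eq: "f ^ k + (\<Sum>i\<in>{1..k}. c i * f ^ (k - i)) = 0"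
    and c: "\<And>i. i \<in> {1..k} \<Longrightarrow> keys (c i) \<subseteq> F i"
    and m: "m \<in> keys f"
  shows "\<exists>n\<ge>1. nmul n m \<in> F n"
proof -
  have "hull (keys f - {m}) m" if m: "m \<in> keys f" for m
  proof (rule ccontr)
    assume ext: "\<not> hull (keys f - {m}) m"
    \<comment> \<open>Here \<open>c i\<close> contributes degree \<open>i \<ge> 1\<close> from
      \<open>F\<close>, so at most \<open>k - i < k\<close> copies of \<open>m\<close> can be
      cancelled.\<close>
    have "nmul k m \<notin> keys (c i * f ^ (k - i))" if i: "i \<in> {1..k}" for i
    proof
      assume "nmul k m \<in> keys (c i * f ^ (k - i))"
      then obtain a b where ab: "nmul k m = a + b" "a \<in> keys (c i)" "b \<in> keys (f ^ (k - i))"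
        using keys_mult[of "c i" "f ^ (k - i)"] by auto
      then have "gen (insert m (keys f - {m})) (k - i) b"
        using keys_power_gen[of b f "k - i"] m by (simp add: insert_absorb)
      then obtain j y where jy: "j \<le> k - i" "b = y + nmul j m" "gen (keys f - {m}) (k - i - j) y"
        by (rule gen_insertE)
      have "gen (keys f - {m}) i a" using ab c[OF i] by (auto intro: gen.base)
      then have "gen (keys f - {m}) (i + (k - i - j)) (a + y)" using jy gen_add by blast
      moreover have "i + (k - i - j) = k - j" "j < k" using i jy by auto
      ultimately have "hull (keys f - {m}) m"
        using jy ab by (intro hull_if_gen_nmul[of _ k j "a + y"]) (auto simp: ac_simps)
      with ext show False by simp
    qed
    then have "lookup (\<Sum>i\<in>{1..k}. c i * f ^ (k - i)) (nmul k m) = 0"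
      by (simp add: lookup_sum in_keys_iff)
    then have "lookup (f ^ k) (nmul k m) = 0"
      using arg_cong[OF eq, of "\<lambda>p. lookup p (nmul k m)"] by (simp add: lookup_add)
    then show False using lookup_power_extremal[OF ext m] m by (simp add: in_keys_iff)
  qed
  then have "hull {} m" using hull_empty_if_hull_others[of "keys f"] m by simp
  then show ?thesis by (simp add: hull_def gen_empty)
qed

end

section \<open>Monomial ideals\<close>

lemma poly_ring_simps [simp]:
  "mult (poly_ring V) = (*)" "one (poly_ring V) = 1"
  "zero (poly_ring V) = 0" "add (poly_ring V) = (+)"
  by (simp_all add: poly_ring_def)

lemma carrier_poly_ring_iff: "p \<in> carrier (poly_ring V) \<longleftrightarrow> (\<forall>m\<in>keys p. keys m \<subseteq> V)"
  by (simp add: poly_ring_def)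

lemma nat_pow_poly_ring [simp]:
  "f [^]\<^bsub>poly_ring V\<^esub> (n::nat) = (f :: ('v, 'k::field) mpoly) ^ n"
  by (induction n) (simp_all add: mult.commute)

lemma finsum_poly_ring:
  fixes g :: "'i \<Rightarrow> ('v, 'k::field) mpoly"
  assumes "finite A" "\<And>i. i \<in> A \<Longrightarrow> g i \<in> carrier (poly_ring V)"
  shows "finsum (poly_ring V) g A = sum g A"
proof -
  interpret R: cring "poly_ring V :: ('v, 'k) mpoly ring" by (rule cring_poly_ring)
  from assms show ?thesis
    by (induction A rule: finite_induct) (simp_all add: R.finsum_insert Pi_def)
qed

text \<open>An ideal when \<open>A\<close> is closed upward; for general \<open>A\<close> only a
  subspace. \<open>A\<close> may contain exponents with variables outside \<open>V\<close>, which
  the carrier cuts off, so \<open>UNIV\<close> yields the whole ring.\<close>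

definition monomial_ideal :: "'v set \<Rightarrow> ('v \<Rightarrow>\<^sub>0 nat) set \<Rightarrow> ('v, 'k::field) mpoly set" where
  "monomial_ideal V A = {p \<in> carrier (poly_ring V). keys p \<subseteq> A}"

lemma monomial_ideal_add:
  "p \<in> monomial_ideal V A \<Longrightarrow> q \<in> monomial_ideal V A \<Longrightarrow> p + q \<in> monomial_ideal V A"
  using keys_add[of p q] unfolding monomial_ideal_def carrier_poly_ring_iff by blast

lemma monomial_ideal_mult:
  assumes "p \<in> monomial_ideal V A" "q \<in> monomial_ideal V B"
  shows "p * q \<in> monomial_ideal V {a + b |a b. a \<in> A \<and> b \<in> B}"
proof -
  have "keys m \<subseteq> V \<and> m \<in> {a + b |a b. a \<in> A \<and> b \<in> B}" if m: "m \<in> keys (p * q)" for m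
  proof -
    obtain a b where "m = a + b" "a \<in> keys p" "b \<in> keys q"
      using m keys_mult[of p q] by blast
    moreover from this have "a \<in> A" "b \<in> B" "keys a \<subseteq> V" "keys b \<subseteq> V"
      using assms by (auto simp: monomial_ideal_def carrier_poly_ring_iff)
    ultimately show ?thesis by (auto simp: keys_add_nat)
  qed
  then show ?thesis unfolding monomial_ideal_def carrier_poly_ring_iff by blast
qed

lemma single_mem_monomial_ideal:
  "m \<in> A \<Longrightarrow> keys m \<subseteq> V \<Longrightarrow> Poly_Mapping.single m c \<in> monomial_ideal V A"
  by (simp add: monomial_ideal_def carrier_poly_ring_iff)

lemma monomial_ideal_induct [consumes 1, case_names zero add single]:
  assumes "p \<in> monomial_ideal V A"
    and "P 0"
    and "\<And>p q. P p \<Longrightarrow> P q \<Longrightarrow> P (p + q)"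
    and "\<And>m c. m \<in> A \<Longrightarrow> keys m \<subseteq> V \<Longrightarrow> P (Poly_Mapping.single m c)"
  shows "P p"
proof -
  have "P (\<Sum>m\<in>S. Poly_Mapping.single m (lookup p m))" if "finite S" "S \<subseteq> keys p" for S
    using that
  proof (induction S rule: finite_induct)
    case (insert m S)
    with assms(1) have "m \<in> A" "keys m \<subseteq> V"
      by (auto simp: monomial_ideal_def carrier_poly_ring_iff)
    with insert assms(3,4) show ?case by simp
  qed (simp add: assms(2))
  from this[of "keys p"] show ?thesis by (simp add: sum_single_lookup)
qed

lemma ideal_monomial_ideal:
  assumes "\<And>a b. a \<in> A \<Longrightarrow> a + b \<in> A"
  shows "ideal (monomial_ideal V A :: ('v, 'k::field) mpoly set) (poly_ring V)"
proof -
  let ?R = "poly_ring V :: ('v, 'k) mpoly ring"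
  let ?I = "monomial_ideal V A :: ('v, 'k) mpoly set"
  interpret R: cring ?R by (rule cring_poly_ring)
  have carr: "?I \<subseteq> carrier ?R" by (auto simp: monomial_ideal_def)
  have absorb: "p * q \<in> ?I" if "p \<in> ?I" "q \<in> carrier ?R" for p q
  proof -
    have "p * q \<in> monomial_ideal V {a + b |a b. a \<in> A \<and> b \<in> UNIV}"
      using that by (intro monomial_ideal_mult) (auto simp: monomial_ideal_def)
    then show ?thesis using assms by (auto simp: monomial_ideal_def)
  qed
  show ?thesis
  proof (rule idealI)
    show "subgroup ?I (add_monoid ?R)"
    proof (rule R.add.subgroupI)
      show "?I \<noteq> {}" by (auto simp: monomial_ideal_def intro!: exI[of _ 0] R.zero_closed[simplified])
      fix a assume a: "a \<in> ?I"
      \<comment> \<open>Closure under negation is reduced to absorption by multiplying with the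
        inverse of one.\<close>
      have "\<ominus>\<^bsub>?R\<^esub> a = a * \<ominus>\<^bsub>?R\<^esub> 1"
        using a carr R.r_minus[of a "\<one>\<^bsub>?R\<^esub>"] R.one_closed by auto
      also have "\<dots> \<in> ?I" using a R.a_inv_closed[OF R.one_closed] by (auto intro: absorb)
      finally show "\<ominus>\<^bsub>?R\<^esub> a \<in> ?I" .
    qed (use carr in \<open>auto intro: monomial_ideal_add\<close>)
  qed (use absorb R.ring_axioms in \<open>auto simp: mult.commute\<close>)
qed

lemma ideal_prod_monomial_ideal:
  "ideal_prod (poly_ring V) (monomial_ideal V A) (monomial_ideal V B) =
    (monomial_ideal V {a + b |a b. a \<in> A \<and> b \<in> B} :: ('v, 'k::field) mpoly set)"
  (is "?L = ?M")
proof (intro equalityI subsetI)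
  fix p assume "p \<in> ?L"
  then show "p \<in> ?M"
    by (induction rule: ideal_prod.induct) (auto intro: monomial_ideal_mult monomial_ideal_add)
next
  fix p assume "p \<in> ?M"
  then show "p \<in> ?L"
  proof (induction rule: monomial_ideal_induct)
    case zero
    have "0 \<in> monomial_ideal V A" "0 \<in> monomial_ideal V B"
      by (simp_all add: monomial_ideal_def carrier_poly_ring_iff)
    from ideal_prod.prod[OF this, of "poly_ring V"] show ?case by simp
  next
    case (add p q)
    then show ?case using ideal_prod.sum[of p "poly_ring V"] by fastforce
  next
    case (single m c)
    \<comment> \<open>Natural exponents cannot cancel, so both factors involve only variables of
      \<open>V\<close>.\<close>
    then obtain a b where ab: "m = a + b" "a \<in> A" "b \<in> B" "keys a \<subseteq> V" "keys b \<subseteq> V"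
      by (auto simp: keys_add_nat)
    then have "Poly_Mapping.single a 1 \<otimes>\<^bsub>poly_ring V\<^esub> Poly_Mapping.single b c \<in> ?L"
      by (intro ideal_prod.prod single_mem_monomial_ideal)
    then show ?case by (simp add: mult_single ab)
  qed
qed

section \<open>Powers of cover ideals\<close>

lemma vertex_cover_mono:
  "vertex_cover V E W \<Longrightarrow> W \<subseteq> W' \<Longrightarrow> W' \<subseteq> V \<Longrightarrow> vertex_cover V E W'"
  unfolding vertex_cover_def by blast

text \<open>Exponents of the monomials divisible by a product of \<open>t\<close> covers; only the variables in \<open>V\<close>
  are taken into account.\<close>

primrec cover_exps :: "'v set \<Rightarrow> 'v set set \<Rightarrow> nat \<Rightarrow> ('v \<Rightarrow>\<^sub>0 nat) set" where
  "cover_exps V E 0 = UNIV"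
| "cover_exps V E (Suc t) =
     {a + b |a b. a \<in> cover_exps V E t \<and> vertex_cover V E (V \<inter> keys b)}"

lemma cover_exps_SucI:
  "x = a + b \<Longrightarrow> a \<in> cover_exps V E t \<Longrightarrow> vertex_cover V E (V \<inter> keys b)
    \<Longrightarrow> x \<in> cover_exps V E (Suc t)"
  by auto

lemma cover_exps_mono:
  "x \<in> cover_exps V E t \<Longrightarrow> \<forall>u\<in>V. lookup x u \<le> lookup y u \<Longrightarrow> y \<in> cover_exps V E t"
proof (induction t arbitrary: x y)
  case (Suc t)
  then obtain a b where ab: "x = a + b" "a \<in> cover_exps V E t" "vertex_cover V E (V \<inter> keys b)"
    by auto
  have le: "lookup a u + lookup b u \<le> lookup y u" if "u \<in> V" for u
    using Suc.prems that ab by (simp add: lookup_add)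
  show ?case
  proof (rule cover_exps_SucI)
    \<comment> \<open>With truncated subtraction \<open>y - (y - b)\<close> is the minimum of
      \<open>y\<close> and \<open>b\<close>. The splitting is therefore exact also outside
      \<open>V\<close>, where \<open>b\<close> may exceed \<open>y\<close>, and on \<open>V\<close>
      the second part agrees with \<open>b\<close>.\<close>
    show "y = (y - b) + (y - (y - b))"
    proof (rule poly_mapping_eqI)
      fix u
      have "lookup y u = (lookup y u - lookup b u) + (lookup y u - (lookup y u - lookup b u))"
        by linarith
      then show "lookup y u = lookup ((y - b) + (y - (y - b))) u"
        by (simp only: lookup_add lookup_minus)
    qed
    show "y - b \<in> cover_exps V E t"
    proof (rule Suc.IH[OF ab(2)], intro ballI)
      fix u assume "u \<in> V"
      from le[OF this] show "lookup a u \<le> lookup (y - b) u" by (simp add: lookup_minus)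
    qed
    have "lookup (y - (y - b)) u = lookup b u" if "u \<in> V" for u
      using le[OF that] by (simp add: lookup_minus)
    then have "V \<inter> keys (y - (y - b)) = V \<inter> keys b"
      by (auto simp: in_keys_iff)
    then show "vertex_cover V E (V \<inter> keys (y - (y - b)))" using ab by simp
  qed
qed simp

lemma cover_exps_add_right: "a \<in> cover_exps V E t \<Longrightarrow> a + b \<in> cover_exps V E t"
  by (erule cover_exps_mono) (simp add: lookup_add)

lemma cover_exps_add:
  "a \<in> cover_exps V E s \<Longrightarrow> b \<in> cover_exps V E t \<Longrightarrow> a + b \<in> cover_exps V E (s + t)"
proof (induction t arbitrary: b)
  case 0
  then show ?case by (simp add: cover_exps_add_right)
next
  case (Suc t)
  then obtain c d where "b = c + d" "c \<in> cover_exps V E t" "vertex_cover V E (V \<inter> keys d)"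
    by auto
  moreover from this Suc have "a + c \<in> cover_exps V E (s + t)" by blast
  ultimately show ?case
    unfolding add_Suc_right by (intro cover_exps_SucI[of _ "a + c" d]) (simp_all add: add.assoc)
qed

lemma cover_exps_add_eq:
  "{a + b |a b. a \<in> cover_exps V E s \<and> b \<in> cover_exps V E t} = cover_exps V E (s + t)"
proof -
  have "\<exists>a b. x = a + b \<and> a \<in> cover_exps V E s \<and> b \<in> cover_exps V E t"
    if "x \<in> cover_exps V E (s + t)" for x
    using that
  proof (induction t arbitrary: x)
    case 0
    then show ?case by (intro exI[of _ x] exI[of _ 0]) simp
  next
    case (Suc t)
    then obtain y d where "x = y + d" "y \<in> cover_exps V E (s + t)" "vertex_cover V E (V \<inter> keys d)"
      by auto
    moreover from Suc.IH[OF this(2)] obtain a b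
      where "y = a + b" "a \<in> cover_exps V E s" "b \<in> cover_exps V E t" by blast
    moreover from this calculation(3) have "b + d \<in> cover_exps V E (Suc t)"
      by (intro cover_exps_SucI[of _ b d]) simp_all
    ultimately show ?case
      by (intro exI[of _ a] exI[of _ "b + d"] conjI) (simp_all only: add.assoc)
  qed
  moreover have "x \<in> cover_exps V E (s + t)"
    if "\<exists>a b. x = a + b \<and> a \<in> cover_exps V E s \<and> b \<in> cover_exps V E t" for x
    using that cover_exps_add by blast
  ultimately show ?thesis by (intro Set.set_eqI iffI) simp_all
qed

lemma cover_exps_1: "cover_exps V E 1 = {b. vertex_cover V E (V \<inter> keys b)}"
proof (intro Set.set_eqI iffI)
  fix x assume "x \<in> cover_exps V E 1"
  then obtain a b where "x = a + b" "vertex_cover V E (V \<inter> keys b)" by auto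
  then show "x \<in> {b. vertex_cover V E (V \<inter> keys b)}"
    using vertex_cover_mono[of V E "V \<inter> keys b" "V \<inter> keys x"] by (auto simp: keys_add_nat)
next
  fix x :: "'a \<Rightarrow>\<^sub>0 nat" assume "x \<in> {b. vertex_cover V E (V \<inter> keys b)}"
  then show "x \<in> cover_exps V E 1"
    unfolding One_nat_def by (intro cover_exps_SucI[of x 0 x]) simp_all
qed

text \<open>Powers of the \<open>t\<close>-th power are needed because normality asks for integral
  equations over that ideal. For \<open>n = 0\<close> both sides are the whole ring.\<close>

lemma ideal_power_cover_exps:
  "ideal_power (poly_ring V) (monomial_ideal V (cover_exps V E t)) n =
    (monomial_ideal V (cover_exps V E (t * n)) :: ('v, 'k::field) mpoly set)"
proof (induction n)
  case 0
  show ?case by (simp add: ideals_set_def monomial_ideal_def)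
next
  case (Suc n)
  have "ideal_power (poly_ring V) (monomial_ideal V (cover_exps V E t)) (Suc n) =
      ideal_prod (poly_ring V) (monomial_ideal V (cover_exps V E (t * n)) :: ('v, 'k) mpoly set)
        (monomial_ideal V (cover_exps V E t))"
    using Suc by (simp add: ideals_set_def)
  then show ?case by (simp add: ideal_prod_monomial_ideal cover_exps_add_eq add.commute)
qed

section \<open>Minimal covers and the generators of the cover ideal\<close>

lemma minimal_vertex_cover_subset:
  assumes "finite W" "vertex_cover V E W"
  obtains W' where "W' \<subseteq> W" "minimal_vertex_cover V E W'"
proof -
  have "\<exists>W'\<subseteq>W. minimal_vertex_cover V E W'"
    using assms
  proof (induction W rule: finite_psubset_induct)
    case (psubset W)
    show ?case
    proof (cases "minimal_vertex_cover V E W")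
      case False
      then obtain W' where "W' \<subset> W" "vertex_cover V E W'"
        using psubset.prems by (auto simp: minimal_vertex_cover_def)
      with psubset.IH[of W'] show ?thesis by (meson order_trans psubset_imp_subset)
    qed auto
  qed
  with that show thesis by blast
qed

lemma prod_var:
  "finite W \<Longrightarrow> (\<Prod>u\<in>W. var u :: ('v, 'k::field) mpoly) =
    Poly_Mapping.single (\<Sum>u\<in>W. Poly_Mapping.single u 1) 1"
  by (induction W rule: finite_induct) (simp_all add: var_def mult_single)

lemma lookup_sum_single:
  "finite W \<Longrightarrow> lookup (\<Sum>u\<in>W. Poly_Mapping.single u (Suc 0)) x = (if x \<in> W then 1 else 0)"
  by (simp add: lookup_sum lookup_single when_def)

text \<open>A monomial whose support in \<open>V\<close> is a cover is divisible by the generator of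
  any minimal cover inside that support; conversely, the support of each generator is a
  cover.\<close>

lemma cover_ideal_eq_monomial_ideal:
  assumes "finite V"
  shows "cover_ideal V E = (monomial_ideal V (cover_exps V E 1) :: ('v, 'k::field) mpoly set)"
    (is "?J = ?M")
proof
  let ?R = "poly_ring V :: ('v, 'k) mpoly ring"
  let ?gens = "{(\<Prod>u\<in>W. var u :: ('v, 'k) mpoly) |W. minimal_vertex_cover V E W}"
  interpret R: cring ?R by (rule cring_poly_ring)
  define X :: "'v set \<Rightarrow> 'v \<Rightarrow>\<^sub>0 nat" where "X W = (\<Sum>u\<in>W. Poly_Mapping.single u 1)" for W
  have keys_X: "keys (X W) = W" if "W \<subseteq> V" for W
    using that finite_subset[OF that assms] by (auto simp: X_def in_keys_iff lookup_sum_single split: if_splits)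
  have prod_X: "(\<Prod>u\<in>W. var u) = (Poly_Mapping.single (X W) 1 :: ('v, 'k) mpoly)" if "W \<subseteq> V" for W
    using that finite_subset[OF that assms] by (simp add: X_def prod_var)
  have mvc: "W \<subseteq> V \<and> vertex_cover V E W" if "minimal_vertex_cover V E W" for W
    using that by (auto simp: minimal_vertex_cover_def vertex_cover_def)
  have gens: "?gens \<subseteq> ?M"
  proof
    fix p assume "p \<in> ?gens"
    then obtain W where "p = (\<Prod>u\<in>W. var u)" "minimal_vertex_cover V E W" by blast
    with mvc[of W] have W: "W \<subseteq> V" "vertex_cover V E W" "p = Poly_Mapping.single (X W) 1"
      by (auto simp: prod_X)
    then have "X W \<in> cover_exps V E 1"
      unfolding cover_exps_1 by (simp add: keys_X Int_absorb1)
    with W show "p \<in> ?M" by (simp add: keys_X single_mem_monomial_ideal del: One_nat_def)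
  qed
  show "?J \<subseteq> ?M"
    unfolding cover_ideal_def
    using gens by (intro R.genideal_minimal ideal_monomial_ideal cover_exps_add_right)
  have "?gens \<subseteq> carrier ?R" using gens by (auto simp: monomial_ideal_def)
  then have J: "ideal ?J ?R" "?gens \<subseteq> ?J"
    unfolding cover_ideal_def using R.genideal_ideal R.genideal_self by auto
  show "?M \<subseteq> ?J"
  proof
    fix p assume "p \<in> ?M"
    then show "p \<in> ?J"
    proof (induction rule: monomial_ideal_induct)
      case zero
      show ?case using additive_subgroup.zero_closed[OF ideal.axioms(1)[OF J(1)]] by simp
    next
      case (add p q)
      then show ?case using additive_subgroup.a_closed[OF ideal.axioms(1)[OF J(1)]] by simp
    next
      case (single m c)
      then have "vertex_cover V E (V \<inter> keys m)" unfolding cover_exps_1 by simp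
      moreover have "finite (V \<inter> keys m)" by simp
      ultimately obtain W where "W \<subseteq> V \<inter> keys m" "minimal_vertex_cover V E W"
        by (metis minimal_vertex_cover_subset)
      then have W: "W \<subseteq> keys m" "minimal_vertex_cover V E W" by simp_all
      with mvc have WV: "W \<subseteq> V" by blast
      \<comment> \<open>The subtraction is exact because \<open>m\<close> has exponent at least one
        at each vertex of \<open>W\<close>.\<close>
      have m: "m = (m - X W) + X W"
      proof (rule poly_mapping_eqI)
        fix u
        have "lookup (X W) u \<le> lookup m u"
          using W WV finite_subset[OF WV assms] by (auto simp: X_def lookup_sum_single in_keys_iff)
        then show "lookup m u = lookup ((m - X W) + X W) u" by (simp add: lookup_add lookup_minus)
      qed
      then have "keys (m - X W) \<subseteq> V" using single by (metis keys_add_nat le_sup_iff)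
      then have "Poly_Mapping.single (m - X W) c \<in> carrier ?R"
        by (simp add: carrier_poly_ring_iff)
      moreover have "Poly_Mapping.single (X W) 1 \<in> ?J" using J W prod_X[OF WV] by force
      ultimately have "Poly_Mapping.single (m - X W) c * Poly_Mapping.single (X W) 1 \<in> ?J"
        using ideal.I_l_closed[OF J(1)] by fastforce
      then show ?case using m by (simp add: mult_single)
    qed
  qed
qed

lemma ideal_power_cover_ideal:
  "finite V \<Longrightarrow> ideal_power (poly_ring V) (cover_ideal V E) t =
    (monomial_ideal V (cover_exps V E t) :: ('v, 'k::field) mpoly set)"
  using ideal_power_cover_exps[of V E 1 t] by (simp add: cover_ideal_eq_monomial_ideal)

section \<open>Normality of cover ideals\<close>

lemma integral_over_poly_ring_iff:
  fixes f :: "('v, 'k::field) mpoly"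
  assumes "f \<in> carrier (poly_ring V)" "\<And>i. ideal_power (poly_ring V) I i \<subseteq> carrier (poly_ring V)"
  shows "integral_over (poly_ring V) I f \<longleftrightarrow>
    (\<exists>k c. k \<ge> 1 \<and> (\<forall>i\<in>{1..k}. c i \<in> ideal_power (poly_ring V) I i) \<and>
       f ^ k + (\<Sum>i\<in>{1..k}. c i * f ^ (k - i)) = 0)"
proof -
  interpret R: cring "poly_ring V :: ('v, 'k) mpoly ring" by (rule cring_poly_ring)
  have "finsum (poly_ring V) (\<lambda>i. c i * f ^ (k - i)) {1..k} = (\<Sum>i\<in>{1..k}. c i * f ^ (k - i))"
    if "\<forall>i\<in>{1..k}. c i \<in> ideal_power (poly_ring V) I i" for c and k :: nat
  proof (rule finsum_poly_ring)
    fix i assume "i \<in> {1..k}"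
    then have "c i \<in> carrier (poly_ring V)" using that assms by blast
    then show "c i * f ^ (k - i) \<in> carrier (poly_ring V)"
      using R.m_closed R.nat_pow_closed[OF assms(1), of "k - i"] by simp
  qed simp
  then show ?thesis unfolding integral_over_def by (auto cong: conj_cong)
qed

text \<open>The criterion does not mention the field. Necessity comes from an explicit integral
  equation for a monomial, sufficiency from \<open>integral_imp_multiple_mem\<close>.\<close>

lemma normal_cover_ideal_iff:
  assumes "finite V"
  shows "normal_ideal (poly_ring V) (cover_ideal V E :: ('v, 'k::field) mpoly set) \<longleftrightarrow>
    (\<forall>t\<ge>1. \<forall>m. keys m \<subseteq> V \<longrightarrow> (\<exists>n\<ge>1. nmul n m \<in> cover_exps V E (t * n)) \<longrightarrow>
       m \<in> cover_exps V E t)"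
proof -
  have "integrally_closed (poly_ring V) (ideal_power (poly_ring V) (cover_ideal V E :: ('v, 'k) mpoly set) t)
    \<longleftrightarrow> (\<forall>m. keys m \<subseteq> V \<longrightarrow> (\<exists>n\<ge>1. nmul n m \<in> cover_exps V E (t * n)) \<longrightarrow> m \<in> cover_exps V E t)"
    (is "?closed \<longleftrightarrow> ?multiples") for t
  proof -
    let ?R = "poly_ring V :: ('v, 'k) mpoly ring"
    let ?I = "monomial_ideal V (cover_exps V E t) :: ('v, 'k) mpoly set"
    have int_iff: "integral_over ?R ?I f \<longleftrightarrow>
        (\<exists>k c. k \<ge> 1 \<and> (\<forall>i\<in>{1..k}. c i \<in> monomial_ideal V (cover_exps V E (t * i))) \<and>
           f ^ k + (\<Sum>i\<in>{1..k}. c i * f ^ (k - i)) = 0)" if "f \<in> carrier ?R" for f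
      using integral_over_poly_ring_iff[of f V ?I, unfolded ideal_power_cover_exps] that
      by (simp add: monomial_ideal_def)
    have sub: "?I \<subseteq> integral_closure ?R ?I"
    proof
      fix f assume f: "f \<in> ?I"
      then have carr: "f \<in> carrier ?R" and "- f \<in> ?I"
        by (simp_all add: monomial_ideal_def carrier_poly_ring_iff)
      then have "integral_over ?R ?I f"
        \<comment> \<open>The equation of degree one with constant term \<open>- f\<close>.\<close>
        unfolding int_iff[OF carr] by (intro exI[of _ 1] exI[of _ "\<lambda>_. - f"]) simp
      with carr show "f \<in> integral_closure ?R ?I" by (simp add: integral_closure_def)
    qed
    have "?closed \<longleftrightarrow> integral_closure ?R ?I \<subseteq> ?I"
      using sub by (auto simp: integrally_closed_def ideal_power_cover_ideal assms)
    also have "\<dots> \<longleftrightarrow> ?multiples"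
    proof (intro iffI allI impI)
      fix m assume closed: "integral_closure ?R ?I \<subseteq> ?I" and m: "keys m \<subseteq> V"
        and "\<exists>n\<ge>1. nmul n m \<in> cover_exps V E (t * n)"
      then obtain n where n: "n \<ge> 1" "nmul n m \<in> cover_exps V E (t * n)" by blast
      define f :: "('v, 'k) mpoly" where "f = Poly_Mapping.single m 1"
      \<comment> \<open>These coefficients encode the equation \<open>X^n - f^n = 0\<close>: only
        the last one is nonzero, and it is a monomial of exponent \<open>n m\<close> up to
        sign.\<close>
      define c where "c i = (if i = n then - (f ^ n) else 0)" for i
      have f: "f \<in> carrier ?R" using m by (simp add: f_def carrier_poly_ring_iff)
      have "keys (nmul n m) \<subseteq> V" using m by (auto simp: in_keys_iff)
      then have "f ^ n \<in> monomial_ideal V (cover_exps V E (t * n))"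
        unfolding f_def single_power using n by (intro single_mem_monomial_ideal)
      then have "\<forall>i\<in>{1..n}. c i \<in> monomial_ideal V (cover_exps V E (t * i))"
        by (auto simp: c_def monomial_ideal_def carrier_poly_ring_iff)
      moreover have "(\<Sum>i\<in>{1..n}. c i * f ^ (n - i)) = (\<Sum>i\<in>{1..n}. if i = n then - (f ^ n) else 0)"
        by (rule sum.cong) (auto simp: c_def)
      then have "f ^ n + (\<Sum>i\<in>{1..n}. c i * f ^ (n - i)) = 0" using n by simp
      ultimately have "integral_over ?R ?I f" using n f int_iff by blast
      then have "f \<in> ?I" using closed f by (auto simp: integral_closure_def)
      then show "m \<in> cover_exps V E t" by (simp add: monomial_ideal_def f_def)
    next
      assume mult: ?multiples
      \<comment> \<open>The filtration given by the powers of the ideal \<open>?I\<close>.\<close>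
      interpret exponent_filtration "\<lambda>i. cover_exps V E (t * i)"
        by unfold_locales (auto simp: distrib_left intro: cover_exps_add)
      show "integral_closure ?R ?I \<subseteq> ?I"
      proof
        fix f assume "f \<in> integral_closure ?R ?I"
        then have f: "f \<in> carrier ?R" and "integral_over ?R ?I f" by (auto simp: integral_closure_def)
        then obtain k c where kc: "\<forall>i\<in>{1..k}. c i \<in> monomial_ideal V (cover_exps V E (t * i))"
          "f ^ k + (\<Sum>i\<in>{1..k}. c i * f ^ (k - i)) = 0"
          by (auto simp: int_iff)
        have "m \<in> cover_exps V E t" if m: "m \<in> keys f" for m
        proof -
          have "\<exists>n\<ge>1. nmul n m \<in> cover_exps V E (t * n)"
            using kc m by (intro integral_imp_multiple_mem[of f k c]) (auto simp: monomial_ideal_def)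
          moreover have "keys m \<subseteq> V" using f m by (auto simp: carrier_poly_ring_iff)
          ultimately show ?thesis using mult by blast
        qed
        with f show "f \<in> ?I" by (auto simp: monomial_ideal_def)
      qed
    qed
    finally show ?thesis .
  qed
  then show ?thesis by (simp add: normal_ideal_def)
qed

section \<open>Attaching a leaf\<close>

text \<open>The old edges do not contain \<open>w\<close>, so only the new edge adds a
  condition.\<close>

lemma vertex_cover_leaf_iff:
  assumes "\<forall>e\<in>E. e \<subseteq> V" "w \<notin> V" "v \<in> V"
  shows "vertex_cover (V \<union> {w}) (E \<union> {{v, w}}) ((V \<union> {w}) \<inter> S) \<longleftrightarrow>
    vertex_cover V E (V \<inter> S) \<and> (v \<in> S \<or> w \<in> S)"
proof -
  have "(V \<union> {w}) \<inter> S \<inter> e = V \<inter> S \<inter> e" if "e \<in> E" for e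
    using assms that by blast
  then show ?thesis unfolding vertex_cover_def using assms by auto
qed

text \<open>Of \<open>t\<close> covers of \<open>G\<close> with product dividing \<open>x\<^sup>a\<close>, exactly \<open>c\<close> contain \<open>v\<close>. Each of the
  other \<open>t - c\<close> becomes a cover of \<open>H\<close> by adding either \<open>v\<close> or \<open>w\<close>.\<close>

lemma cover_exps_leaf_extend:
  assumes "\<forall>e\<in>E. e \<subseteq> V" "w \<notin> V" "v \<in> V"
    and "a \<in> cover_exps V E t"
  shows "\<exists>c n. c \<le> t \<and> c \<le> lookup a v \<and> lookup n v = 0 \<and> lookup n w = 0 \<and>
    (\<forall>u. lookup n u \<le> lookup a u) \<and>
    (\<forall>p q. p + q + c = t \<longrightarrow>
      n + Poly_Mapping.single v (c + p) + Poly_Mapping.single w q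
        \<in> cover_exps (V \<union> {w}) (E \<union> {{v, w}}) t)"
  using assms(4)
proof (induction t arbitrary: a)
  case 0
  show ?case by (intro exI[of _ 0]) simp
next
  case (Suc t)
  let ?V = "V \<union> {w}" and ?E = "E \<union> {{v, w}}"
  have vw: "v \<noteq> w" using assms by blast
  from Suc.prems obtain a' b where ab: "a = a' + b" "a' \<in> cover_exps V E t"
    "vertex_cover V E (V \<inter> keys b)" by auto
  from Suc.IH[OF ab(2)] obtain c n where cn: "c \<le> t" "c \<le> lookup a' v" "lookup n v = 0"
    "lookup n w = 0" "\<And>u. lookup n u \<le> lookup a' u"
    "\<And>p q. p + q + c = t \<Longrightarrow>
       n + Poly_Mapping.single v (c + p) + Poly_Mapping.single w q \<in> cover_exps ?V ?E t"
    by blast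
  \<comment> \<open>The part of \<open>b\<close> away from \<open>v\<close> and \<open>w\<close>.
    Such parts add up to \<open>n\<close>, while the exponents of \<open>v\<close> and
    \<open>w\<close> are accounted for by \<open>c\<close>, \<open>p\<close> and
    \<open>q\<close>.\<close>
  define b' where "b' = Poly_Mapping.update v 0 (Poly_Mapping.update w 0 b)"
  have b': "lookup b' u = (if u = v \<or> u = w then 0 else lookup b u)" for u
    by (auto simp: b'_def lookup_update)
  have keys_b': "keys b' = keys b - {v, w}" by (auto simp: b'_def keys_update)
  have cover_v: "vertex_cover ?V ?E (?V \<inter> keys (b' + Poly_Mapping.single v 1))"
  proof -
    have "vertex_cover V E (V \<inter> keys (b' + Poly_Mapping.single v 1))"
      using ab(3) by (rule vertex_cover_mono) (use assms in \<open>auto simp: keys_add_nat keys_b'\<close>)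
    then show ?thesis using assms by (subst vertex_cover_leaf_iff) (auto simp: keys_add_nat)
  qed
  have n_le: "lookup (n + b') u \<le> lookup a u" for u
    using cn(5)[of u] by (simp add: lookup_add ab b')
  show ?case
  proof (cases "v \<in> keys b")
    case True
    have "n + b' + Poly_Mapping.single v (Suc c + p) + Poly_Mapping.single w q
        \<in> cover_exps ?V ?E (Suc t)" if "p + q + Suc c = Suc t" for p q
      by (rule cover_exps_SucI[OF _ cn(6)[of p q] cover_v])
        (use that in \<open>auto intro!: poly_mapping_eqI simp: lookup_add lookup_single when_def\<close>)
    moreover have "Suc c \<le> lookup a v" using True cn(2) by (simp add: ab lookup_add in_keys_iff)
    ultimately show ?thesis
      using cn n_le by (intro exI[of _ "Suc c"] exI[of _ "n + b'"]) (auto simp: lookup_add b')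
  next
    case False
    have cover_w: "vertex_cover ?V ?E (?V \<inter> keys (b' + Poly_Mapping.single w 1))"
    proof -
      have "vertex_cover V E (V \<inter> keys (b' + Poly_Mapping.single w 1))"
        using ab(3) by (rule vertex_cover_mono) (use assms False in \<open>auto simp: keys_add_nat keys_b'\<close>)
      then show ?thesis using assms by (subst vertex_cover_leaf_iff) (auto simp: keys_add_nat)
    qed
    have "n + b' + Poly_Mapping.single v (c + p) + Poly_Mapping.single w q
        \<in> cover_exps ?V ?E (Suc t)" if pq: "p + q + c = Suc t" for p q
    \<comment> \<open>The last cover lacks \<open>v\<close> and must be completed: by
      \<open>v\<close> if \<open>p\<close> is positive, otherwise by \<open>w\<close>. In the second
      case \<open>q\<close> is positive because \<open>c \<le> t\<close>.\<close>
    proof (cases p)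
      case (Suc p')
      show ?thesis
        by (rule cover_exps_SucI[OF _ cn(6)[of p' q] cover_v])
          (use pq Suc in \<open>auto intro!: poly_mapping_eqI simp: lookup_add lookup_single when_def\<close>)
    next
      case 0
      with pq cn(1) obtain q' where q': "q = Suc q'" by (cases q) auto
      show ?thesis
        by (rule cover_exps_SucI[OF _ cn(6)[of p q'] cover_w])
          (use pq q' in \<open>auto intro!: poly_mapping_eqI simp: lookup_add lookup_single when_def\<close>)
    qed
    then show ?thesis
      using cn n_le by (intro exI[of _ c] exI[of _ "n + b'"]) (auto simp: lookup_add b' ab)
  qed
qed

text \<open>Each of \<open>t\<close> covers of the larger graph contains \<open>v\<close> or
  \<open>w\<close>, which gives the inequality. Conversely, the inequality leaves enough room to
  complete the covers of the smaller graph.\<close>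

lemma cover_exps_leaf_iff:
  assumes "\<forall>e\<in>E. e \<subseteq> V" "w \<notin> V" "v \<in> V"
  shows "m \<in> cover_exps (V \<union> {w}) (E \<union> {{v, w}}) t \<longleftrightarrow>
    m \<in> cover_exps V E t \<and> t \<le> lookup m v + lookup m w"
proof
  assume "m \<in> cover_exps (V \<union> {w}) (E \<union> {{v, w}}) t"
  then show "m \<in> cover_exps V E t \<and> t \<le> lookup m v + lookup m w"
  proof (induction t arbitrary: m)
    case (Suc t)
    then obtain a b where ab: "m = a + b" "a \<in> cover_exps (V \<union> {w}) (E \<union> {{v, w}}) t"
      "vertex_cover (V \<union> {w}) (E \<union> {{v, w}}) ((V \<union> {w}) \<inter> keys b)" by auto
    from ab(3) have "vertex_cover V E (V \<inter> keys b)" "1 \<le> lookup b v + lookup b w"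
      unfolding vertex_cover_leaf_iff[OF assms] by (auto simp: in_keys_iff)
    with Suc.IH[OF ab(2)] ab(1) show ?case by (auto simp: lookup_add)
  qed simp
next
  assume m: "m \<in> cover_exps V E t \<and> t \<le> lookup m v + lookup m w"
  then obtain c n where cn: "c \<le> t" "c \<le> lookup m v" "lookup n v = 0"
    "lookup n w = 0" "\<And>u. lookup n u \<le> lookup m u"
    "\<And>p q. p + q + c = t \<Longrightarrow> n + Poly_Mapping.single v (c + p) + Poly_Mapping.single w q
       \<in> cover_exps (V \<union> {w}) (E \<union> {{v, w}}) t"
    using cover_exps_leaf_extend[OF assms] by blast
  \<comment> \<open>As many covers are completed by \<open>v\<close> as its exponent allows. The
    number left for \<open>w\<close> is zero or \<open>t - lookup m v\<close>, hence at most
    \<open>lookup m w\<close>.\<close>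
  define p where "p = min (t - c) (lookup m v - c)"
  have "n + Poly_Mapping.single v (c + p) + Poly_Mapping.single w (t - c - p)
      \<in> cover_exps (V \<union> {w}) (E \<union> {{v, w}}) t"
    using cn(1) by (intro cn(6)) (auto simp: p_def)
  then show "m \<in> cover_exps (V \<union> {w}) (E \<union> {{v, w}}) t"
  proof (rule cover_exps_mono, intro ballI)
    fix u
    have "v \<noteq> w" using assms by blast
    then show "lookup (n + Poly_Mapping.single v (c + p) + Poly_Mapping.single w (t - c - p)) u
        \<le> lookup m u"
      using cn(1-5) m by (auto simp: lookup_add lookup_single when_def p_def)
  qed
qed

theorem theorem3p3:
  fixes VG VH :: "'v set" and EG EH :: "'v set set" and v w :: 'v
  assumes "simple_graph VG EG" and "simple_graph VH EH"
    and "w \<notin> VG" and "VH = VG \<union> {w}"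
    and "v \<in> VG" and "EH = EG \<union> {{v, w}}"
    and "normal_ideal (poly_ring VG) (cover_ideal VG EG :: ('v, 'k::field) mpoly set)"
  shows "normal_ideal (poly_ring VH) (cover_ideal VH EH :: ('v, 'k) mpoly set)"
proof -
  have fin: "finite VG" "finite VH" and edges: "\<forall>e\<in>EG. e \<subseteq> VG"
    using assms(1,2) by (auto simp: simple_graph_def)
  note leaf_iff = cover_exps_leaf_iff[OF edges assms(3,5), folded assms(4,6)]
  have "m \<in> cover_exps VH EH t"
    if t: "t \<ge> 1" and m: "keys m \<subseteq> VH" and n: "n \<ge> 1" "nmul n m \<in> cover_exps VH EH (t * n)"
    for t m n
  proof -
    \<comment> \<open>The hypothesis on \<open>VG\<close> concerns only exponents supported in
      \<open>VG\<close>, so the exponent of \<open>w\<close> is erased;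
      \<open>cover_exps VG EG\<close> does not see the difference.\<close>
    define m' where "m' = Poly_Mapping.update w 0 m"
    have m': "\<forall>u\<in>VG. lookup m' u = lookup m u" using assms(3) by (auto simp: m'_def lookup_update)
    have "nmul n m \<in> cover_exps VG EG (t * n)" using n leaf_iff by blast
    then have "nmul n m' \<in> cover_exps VG EG (t * n)"
      by (rule cover_exps_mono) (use m' in auto)
    moreover have "keys m' \<subseteq> VG" using m assms(4) by (auto simp: m'_def keys_update)
    ultimately have "m' \<in> cover_exps VG EG t"
      using assms(7) t n(1) unfolding normal_cover_ideal_iff[OF fin(1)] by blast
    then have "m \<in> cover_exps VG EG t" by (rule cover_exps_mono) (use m' in auto)
    moreover have "n * t \<le> n * (lookup m v + lookup m w)"
      using n(2) leaf_iff by (simp add: algebra_simps)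
    then have "t \<le> lookup m v + lookup m w" using n(1) by simp
    ultimately show ?thesis using leaf_iff by blast
  qed
  then show ?thesis unfolding normal_cover_ideal_iff[OF fin(2)] by blast
qed

end
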